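(* Let $\mathcal{U}'\subset\mathcal{U}$ be any set with the orthogonal extension property (OEP) with respect to $\mathcal{U}$. Let $h_1,\dots,h_M$ each be a simple control barrier function (SCBF) for $(\mathcal{S},\mathcal{U}')$, with associated class-$\mathcal{K}$ functions $\alpha_1,\dots,\alpha_M$. If $\{h_k\}_{k=1}^M$ are non-interfering on $\mathcal{S}$, then the set $$\boldsymbol\mu_{\mathrm{all}}(q,v)=\bigcap_{k=1}^M\boldsymbol\mu_k(q,v,\mathcal{U})=\bigcap_{k=1}^M\{u\in\mathcal{U}\mid \dot h_k(q,v,u)\le\alpha_k(-h_k(q,v))\}$$ is nonempty for all $(q,v)\in\mathcal{S}\cap\left(\bigcap_{k=1}^M\mathcal{H}_k\right)$.
   Context: **System.** The state is $x=(q,v)\in\mathbb{R}^{n_1+n_2}$, with $q\in\mathbb{R}^{n_1}$, $v\in\mathbb{R}^{n_2}$, and dynamics $\dot q=g_1(q)v$, $\dot v=f(q,v)+g_2(q)u$, where $f:\mathbb{R}^{n_1}\times\mathbb{R}^{n_2}\to\mathbb{R}^{n_2}$, $g_1:\mathbb{R}^{n_1}\to\mathbb{R}^{n_1\times n_2}$, $g_2:\mathbb{R}^{n_1}\to\mathbb{R}^{n_2\times m}$ are of class $C^2$. The control $u$ takes values in $\mathcal{U}\subset\mathbb{R}^m$, which is compact, convex and contains $0$. **Safe set.** Given $\kappa_i:\mathbb{R}^{n_1}\to\mathbb{R}$ of class $C^2$ ($i=1,\dots,N_1$) and $\eta_j:\mathbb{R}^{n_2}\to\mathbb{R}$ of class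 $C^1$ ($j=1,\dots,N_2$), the safe set is $\mathcal{S}=\left(\bigcap_{i}\{q\mid\kappa_i(q)\le0\}\right)\times\left(\bigcap_{j}\{v\mid\eta_j(v)\le0\}\right)$. **Notation.** $\nabla_q$ and $\nabla_v$ denote gradients (row vectors) in $q$ and $v$. For $C^1$ functions $h:\mathbb{R}^{n_1+n_2}\to\mathbb{R}$, $\dot h(q,v,u)=\nabla_q h(q,v)g_1(q)v+\nabla_v h(q,v)\,(f(q,v)+g_2(q)u)$ is the derivative along the dynamics. A class-$\mathcal{K}$ function is a continuous strictly increasing function on $[0,\infty)$ vanishing at $0$. **CBF and SCBF.** Let $\mathcal{X}\subseteq\mathcal{S}$, $\mathcal{Y}\subseteq\mathcal{U}$. A $C^1$ function $h$ is a *control barrier function (CBF) for $(\mathcal{X},\mathcal{Y})$* if there is a class-$\mathcal{K}$ function $\alpha$ such that $\boldsymbol\mu(q,v,\mathcal{Y})=\{u\in\mathcal{Y}\mid\dot h(q,v,u)\le\alpha(-h(q,v))\}$ is nonempty for all $(q,v)\in\mathcal{H}\cap\mathcal{X}$, where $\mathcal{H}=\{(q,v)\mid h(q,v)\le0\}$. It is a *simple control barrier function (SCBF) for $(\mathcal{X},\mathcal{Y})$* if moreover, for this $\alpha$, the set $\{u\in\boldsymbol\mu(q,v,\mathcal{Y})\mid\exists c\ge0:\ u=-c\,[\nabla_v h(q,v)g_2(q)]^{T}\}$ is nonempty for all $(q,v)\in\mathcal{H}\cap\mathcal{X}$. For $h_k$, the corresponding objects are written $\alpha_k,\boldsymbol\mu_k,\mathcal{H}_k$;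 each $\alpha_k$ is a fixed function witnessing the SCBF property. **Non-interfering.** $\{h_k\}_{k=1}^M$ are *non-interfering on $\mathcal{X}$* if for every pair $i,j$, $(\nabla_v h_i(q,v)g_2(q))\cdot(\nabla_v h_j(q,v)g_2(q))\ge0$ for all $(q,v)\in\mathcal{X}$. **OEP.** $\mathcal{U}'\subset\mathcal{U}$ has the *orthogonal extension property with respect to $\mathcal{U}$* if for every family of $m$ vectors $w_1,\dots,w_m\in\mathcal{U}'$ with $w_i\cdot w_j\ge0$ for all $i,j\in\{1,\dots,m\}$, setting $y_i=w_i-\mathrm{proj}_{\{w_1,\dots,w_{i-1}\}}w_i$ (orthogonal projection onto the span of $w_1,\dots,w_{i-1}$; so $y_1=w_1$), the point $z=\sum_{i=1}^m y_i$ belongs to $\mathcal{U}$. *)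

theory Defs
  imports "HOL-Analysis.Analysis"
begin

definition C1 :: "('a::real_normed_vector \<Rightarrow> 'b::real_normed_vector) \<Rightarrow> bool" where
  "C1 F \<longleftrightarrow> (\<exists>F' :: 'a \<Rightarrow> 'a \<Rightarrow>\<^sub>L 'b.
     (\<forall>x. (F has_derivative blinfun_apply (F' x)) (at x)) \<and> continuous_on UNIV F')"

definition C2 :: "('a::real_normed_vector \<Rightarrow> 'b::real_normed_vector) \<Rightarrow> bool" where
  "C2 F \<longleftrightarrow> (\<exists>F' :: 'a \<Rightarrow> 'a \<Rightarrow>\<^sub>L 'b.
     (\<forall>x. (F has_derivative blinfun_apply (F' x)) (at x)) \<and> C1 F')"

definition gradient :: "(real^'n \<Rightarrow> real) \<Rightarrow> real^'n \<Rightarrow> real^'n" where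
  "gradient F x = (\<chi> i. frechet_derivative F (at x) (axis i 1))"

definition grad_q :: "((real^'n1) \<times> (real^'n2) \<Rightarrow> real) \<Rightarrow> real^'n1 \<Rightarrow> real^'n2 \<Rightarrow> real^'n1" where
  "grad_q h q v = gradient (\<lambda>q'. h (q', v)) q"

definition grad_v :: "((real^'n1) \<times> (real^'n2) \<Rightarrow> real) \<Rightarrow> real^'n1 \<Rightarrow> real^'n2 \<Rightarrow> real^'n2" where
  "grad_v h q v = gradient (\<lambda>v'. h (q, v')) v"

definition safe_set ::
  "nat \<Rightarrow> nat \<Rightarrow> (nat \<Rightarrow> real^'n1 \<Rightarrow> real) \<Rightarrow> (nat \<Rightarrow> real^'n2 \<Rightarrow> real) \<Rightarrow> ((real^'n1) \<times> (real^'n2)) set"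
where
  "safe_set N1 N2 \<kappa> \<eta> = (\<Inter>i\<in>{1..N1}. {q. \<kappa> i q \<le> 0}) \<times> (\<Inter>j\<in>{1..N2}. {v. \<eta> j v \<le> 0})"

text \<open>The system is \<open>q' = g1 q v\<close>, \<open>v' = f (q, v) + g2 q u\<close>. A row vector times a matrix is
  written with \<open>v*\<close>, and a row vector times a column vector is an inner product.\<close>

definition hdot ::
  "((real^'n1) \<times> (real^'n2) \<Rightarrow> real^'n2) \<Rightarrow> (real^'n1 \<Rightarrow> real^'n2^'n1) \<Rightarrow> (real^'n1 \<Rightarrow> real^'m^'n2) \<Rightarrow>
   ((real^'n1) \<times> (real^'n2) \<Rightarrow> real) \<Rightarrow> real^'n1 \<Rightarrow> real^'n2 \<Rightarrow> real^'m \<Rightarrow> real"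
where
  "hdot f g1 g2 h q v u =
     grad_q h q v \<bullet> (g1 q *v v) + grad_v h q v \<bullet> (f (q, v) + g2 q *v u)"

text \<open>Only the values of \<open>\<alpha>\<close> on \<open>[0, \<infinity>)\<close> are constrained; below, \<open>\<alpha>\<close> is
  applied to \<open>- h (q, v)\<close> at points with \<open>h (q, v) \<le> 0\<close>.\<close>

definition class_K :: "(real \<Rightarrow> real) \<Rightarrow> bool" where
  "class_K \<alpha> \<longleftrightarrow> continuous_on {0..} \<alpha> \<and> strict_mono_on {0..} \<alpha> \<and> \<alpha> 0 = 0"

definition Hset :: "((real^'n1) \<times> (real^'n2) \<Rightarrow> real) \<Rightarrow> ((real^'n1) \<times> (real^'n2)) set" where
  "Hset h = {(q, v). h (q, v) \<le> 0}"

definition mu ::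
  "((real^'n1) \<times> (real^'n2) \<Rightarrow> real^'n2) \<Rightarrow> (real^'n1 \<Rightarrow> real^'n2^'n1) \<Rightarrow> (real^'n1 \<Rightarrow> real^'m^'n2) \<Rightarrow>
   ((real^'n1) \<times> (real^'n2) \<Rightarrow> real) \<Rightarrow> (real \<Rightarrow> real) \<Rightarrow>
   real^'n1 \<Rightarrow> real^'n2 \<Rightarrow> (real^'m) set \<Rightarrow> (real^'m) set"
where
  "mu f g1 g2 h \<alpha> q v Y = {u \<in> Y. hdot f g1 g2 h q v u \<le> \<alpha> (- h (q, v))}"

text \<open>\<open>cbf_with f g1 g2 X Y h \<alpha>\<close>: \<open>h\<close> is a control barrier function for \<open>(X, Y)\<close>,
  and \<open>\<alpha>\<close> is a class-K function witnessing this.\<close>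

definition cbf_with ::
  "((real^'n1) \<times> (real^'n2) \<Rightarrow> real^'n2) \<Rightarrow> (real^'n1 \<Rightarrow> real^'n2^'n1) \<Rightarrow> (real^'n1 \<Rightarrow> real^'m^'n2) \<Rightarrow>
   ((real^'n1) \<times> (real^'n2)) set \<Rightarrow> (real^'m) set \<Rightarrow>
   ((real^'n1) \<times> (real^'n2) \<Rightarrow> real) \<Rightarrow> (real \<Rightarrow> real) \<Rightarrow> bool"
where
  "cbf_with f g1 g2 X Y h \<alpha> \<longleftrightarrow>
     C1 h \<and> class_K \<alpha> \<and> (\<forall>(q, v) \<in> Hset h \<inter> X. mu f g1 g2 h \<alpha> q v Y \<noteq> {})"

definition scbf_with ::
  "((real^'n1) \<times> (real^'n2) \<Rightarrow> real^'n2) \<Rightarrow> (real^'n1 \<Rightarrow> real^'n2^'n1) \<Rightarrow> (real^'n1 \<Rightarrow> real^'m^'n2) \<Rightarrow>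
   ((real^'n1) \<times> (real^'n2)) set \<Rightarrow> (real^'m) set \<Rightarrow>
   ((real^'n1) \<times> (real^'n2) \<Rightarrow> real) \<Rightarrow> (real \<Rightarrow> real) \<Rightarrow> bool"
where
  "scbf_with f g1 g2 X Y h \<alpha> \<longleftrightarrow>
     cbf_with f g1 g2 X Y h \<alpha> \<and>
     (\<forall>(q, v) \<in> Hset h \<inter> X.
        {u \<in> mu f g1 g2 h \<alpha> q v Y. \<exists>c\<ge>0. u = - (c *\<^sub>R (grad_v h q v v* g2 q))} \<noteq> {})"

definition non_interfering ::
  "(real^'n1 \<Rightarrow> real^'m^'n2) \<Rightarrow> ((real^'n1) \<times> (real^'n2)) set \<Rightarrow> nat \<Rightarrow>
   (nat \<Rightarrow> (real^'n1) \<times> (real^'n2) \<Rightarrow> real) \<Rightarrow> bool"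
where
  "non_interfering g2 X M h \<longleftrightarrow>
     (\<forall>i\<in>{1..M}. \<forall>j\<in>{1..M}. \<forall>(q, v) \<in> X.
        (grad_v (h i) q v v* g2 q) \<bullet> (grad_v (h j) q v v* g2 q) \<ge> 0)"

definition orth_proj :: "'a::euclidean_space set \<Rightarrow> 'a \<Rightarrow> 'a" where
  "orth_proj S x = (THE p. p \<in> span S \<and> (\<forall>s \<in> span S. orthogonal (x - p) s))"

lemma orth_proj_ex1:
  fixes S :: "'a::euclidean_space set"
  shows "\<exists>!p. p \<in> span S \<and> (\<forall>s \<in> span S. orthogonal (x - p) s)"
proof -
  obtain y z where y: "y \<in> span S" and z: "\<And>w. w \<in> span S \<Longrightarrow> orthogonal z w" and x: "x = y + z"
    using orthogonal_subspace_decomp_exists by blast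
  have "p = y" if p: "p \<in> span S" "\<forall>s \<in> span S. orthogonal (x - p) s" for p
  proof -
    have m: "p - y \<in> span S"
      using p(1) y by (rule span_diff)
    have "(x - p) \<bullet> (p - y) = 0" "(x - y) \<bullet> (p - y) = 0"
      using p(2) z m x by (auto simp: orthogonal_def)
    then have "(p - y) \<bullet> (p - y) = 0"
      by (simp add: inner_diff_left)
    then show ?thesis by simp
  qed
  then show ?thesis
    using y z x by (intro ex1I[of _ y]) auto
qed

definition OEP :: "(real^'m) set \<Rightarrow> (real^'m) set \<Rightarrow> bool" where
  "OEP U' U \<longleftrightarrow>
     (\<forall>w :: nat \<Rightarrow> real^'m.
        (\<forall>i\<in>{1..CARD('m)}. w i \<in> U') \<and>
        (\<forall>i\<in>{1..CARD('m)}. \<forall>j\<in>{1..CARD('m)}. w i \<bullet> w j \<ge> 0) \<longrightarrow>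
        (\<Sum>i=1..CARD('m). w i - orth_proj (w ` {1..<i}) (w i)) \<in> U)"

end

theory Submission
  imports Defs
begin

text \<open>Fix a state and let \<open>w\<^sub>k = - c\<^sub>k d\<^sub>k\<close> be the SCBF control of \<open>h\<^sub>k\<close>, where
  \<open>d\<^sub>k\<close> is the row vector \<open>\<nabla>\<^sub>v h\<^sub>k g\<^sub>2\<close>. The \<open>w\<^sub>k\<close> are pairwise acute, and it suffices to find
  \<open>u \<in> U\<close> in their cone with \<open>w\<^sub>k \<bullet> u \<ge> w\<^sub>k \<bullet> w\<^sub>k\<close> for all \<open>k\<close>. In general no single
  Gram-Schmidt sum \<open>z\<close> provided by the OEP does this, but a convex combination of such sums does.
  The combination is the minimiser \<open>u = \<Sum> \<mu>\<^sub>k w\<^sub>k\<close> of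
  \<open>u \<bullet> u / 2 - \<Sum> \<mu>\<^sub>k (w\<^sub>k \<bullet> w\<^sub>k)\<close> over \<open>\<mu>\<^sub>k \<in> [0, 1]\<close>: by acuteness the upper bounds are
  harmless, so \<open>u\<close> satisfies all the inequalities, with equality where \<open>\<mu>\<^sub>k > 0\<close>.

  By separation, \<open>u\<close> lies in \<open>U\<close> once every linear functional \<open>x\<close> admits a Gram-Schmidt sum
  \<open>z\<close> with \<open>x \<bullet> u \<le> x \<bullet> z\<close>. This goes by induction on the number of vectors. Pick \<open>k\<close> with
  \<open>\<mu>\<^sub>k > 0\<close> and project \<open>x\<close> to \<open>p\<close> in the cone of the other active vectors. If \<open>A\<close> is the
  support of \<open>p\<close> and \<open>u\<^sub>A\<close> the minimiser for \<open>A\<close>, then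
  \<open>x \<bullet> u \<le> p \<bullet> u\<^sub>A + \<mu>\<^sub>k (x - p) \<bullet> w\<^sub>k\<close>. The first term is handled by induction, and
  appending \<open>w\<^sub>k\<close> to a Gram-Schmidt list that spans \<open>A\<close> gains exactly \<open>(x - p) \<bullet> w\<^sub>k\<close>.\<close>

section \<open>Orthogonal projections and Gram-Schmidt sums\<close>

lemma orth_proj_in_span: "orth_proj S x \<in> span S"
  and orth_proj_residual: "s \<in> span S \<Longrightarrow> (x - orth_proj S x) \<bullet> s = 0"
  using theI'[OF orth_proj_ex1[of S x]] by (auto simp: orth_proj_def orthogonal_def)

lemma orth_proj_eq_self:
  assumes "x \<in> span S"
  shows "orth_proj S x = x"
  using orth_proj_residual[of "x - orth_proj S x" S x] assms
  by (simp add: span_diff orth_proj_in_span)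

lemma orth_proj_residual_sym:
  "(x - orth_proj S x) \<bullet> y = x \<bullet> (y - orth_proj S y)"
  using orth_proj_residual[OF orth_proj_in_span[of S y], of x]
    orth_proj_residual[OF orth_proj_in_span[of S x], of y]
  by (simp add: inner_diff_left inner_diff_right inner_commute)

text \<open>Gram-Schmidt runs from the end of the list: the head is orthogonalised last, so
  extending a family by one vector is a Cons.\<close>

fun residual_sum :: "'a::euclidean_space list \<Rightarrow> 'a" where
  "residual_sum [] = 0"
| "residual_sum (w # ws) = residual_sum ws + (w - orth_proj (set ws) w)"

fun indep_list :: "'a::euclidean_space list \<Rightarrow> bool" where
  "indep_list [] \<longleftrightarrow> True"
| "indep_list (w # ws) \<longleftrightarrow> w \<notin> span (set ws) \<and> indep_list ws"

lemma residual_sum_in_span: "residual_sum ws \<in> span (set ws)"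
proof (induction ws)
  case (Cons w ws)
  have "span (set ws) \<subseteq> span (set (w # ws))"
    by (intro span_mono) auto
  then show ?case
    using Cons orth_proj_in_span[of "set ws" w]
    by (auto intro!: span_add span_diff intro: span_base)
qed (simp add: span_zero)

lemma length_indep_list:
  fixes ws :: "'a::euclidean_space list"
  assumes "indep_list ws"
  shows "length ws \<le> DIM('a)"
proof -
  have "independent (set ws) \<and> distinct ws"
    using assms by (induction ws) (auto simp: independent_insertI span_base independent_empty)
  then show ?thesis
    using independent_bound[of "set ws"] by (simp add: distinct_card)
qed

lemma residual_sum_conv_sum:
  "residual_sum (rev xs) = (\<Sum>i<length xs. xs ! i - orth_proj (set (take i xs)) (xs ! i))"
proof (induction xs rule: rev_induct)
  case (snoc x xs)
  have "(\<Sum>i<length xs. (xs @ [x]) ! i - orth_proj (set (take i (xs @ [x]))) ((xs @ [x]) ! i))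
      = (\<Sum>i<length xs. xs ! i - orth_proj (set (take i xs)) (xs ! i))"
    by (intro sum.cong) (auto simp: nth_append)
  with snoc show ?case by simp
qed simp

lemma residual_sum_in_OEP_superset:
  fixes U U' :: "(real^'m) set"
  assumes "OEP U' U" "0 \<in> U" "indep_list ws" "set ws \<subseteq> U'"
    and acute: "\<And>v w. v \<in> set ws \<Longrightarrow> w \<in> set ws \<Longrightarrow> v \<bullet> w \<ge> 0"
  shows "residual_sum ws \<in> U"
proof (cases "ws = []")
  case False
  define xs where "xs = rev ws"
  define n where "n = length xs"
  \<comment> \<open>Repeating the last vector pads the list to length \<open>CARD('m)\<close> without changing the sum;
    \<open>0\<close> is not available because it need not belong to \<open>U'\<close>.\<close>
  define w where "w = (\<lambda>i. xs ! min (i - 1) (n - 1))"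
  have n: "0 < n" "n \<le> CARD('m)"
    using False length_indep_list[OF \<open>indep_list ws\<close>] by (auto simp: n_def xs_def)
  have w_in: "w i \<in> set ws" for i
  proof -
    have "w i \<in> set xs" unfolding w_def by (rule nth_mem) (use n(1) n_def in linarith)
    then show ?thesis by (simp add: xs_def)
  qed
  \<comment> \<open>The OEP numbers its vectors from 1 and list positions start at 0, hence
    \<open>i - 1\<close>.\<close>
  have img: "w ` {1..<i} = set (take (i - 1) xs)" if "i \<le> Suc n" for i
  proof -
    have "w ` {1..<i} = (\<lambda>j. xs ! j) ` {0..<i - 1}"
    proof -
      have "{1..<i} = Suc ` {0..<i - 1}"
        by (cases i) (auto simp: image_Suc_atLeastLessThan)
      moreover have "w (Suc j) = xs ! j" if "j < i - 1" for j
      proof -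
        have "min j (n - 1) = j" using that \<open>i \<le> Suc n\<close> by linarith
        then show ?thesis by (simp add: w_def)
      qed
      ultimately show ?thesis by (simp only: image_image) (auto intro!: image_cong)
    qed
    also have "\<dots> = set (take (i - 1) xs)"
      using that by (intro nth_image) (auto simp: n_def)
    finally show ?thesis .
  qed
  have tail: "w i - orth_proj (w ` {1..<i}) (w i) = 0" if "n < i" for i
  proof -
    have "w i = w n" using that by (simp add: w_def min_def)
    also have "w n \<in> w ` {1..<i}" using that n(1) by auto
    finally show ?thesis by (simp add: orth_proj_eq_self span_base)
  qed
  have "(\<Sum>i=1..CARD('m). w i - orth_proj (w ` {1..<i}) (w i)) \<in> U"
    using \<open>OEP U' U\<close> w_in acute \<open>set ws \<subseteq> U'\<close> unfolding OEP_def by blast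
  also have "(\<Sum>i=1..CARD('m). w i - orth_proj (w ` {1..<i}) (w i))
      = (\<Sum>i=1..n. w i - orth_proj (w ` {1..<i}) (w i))"
    using n(2) tail by (intro sum.mono_neutral_right) auto
  also have "\<dots> = (\<Sum>i<n. w (Suc i) - orth_proj (w ` {1..<Suc i}) (w (Suc i)))"
    by (rule sum.reindex_bij_witness[of _ Suc "\<lambda>i. i - 1"]) auto
  also have "\<dots> = (\<Sum>i<n. xs ! i - orth_proj (set (take i xs)) (xs ! i))"
    by (intro sum.cong refl) (subst img, auto simp: w_def min_def)
  also have "\<dots> = residual_sum ws"
    using residual_sum_conv_sum[of xs] by (simp add: n_def xs_def)
  finally show ?thesis .
qed (use \<open>0 \<in> U\<close> in simp)

section \<open>Projection onto a finitely generated cone\<close>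

lemma convex_cone_hull_finite_sum:
  fixes S :: "'a::real_vector set"
  assumes "finite S" "p \<in> convex_cone hull S"
  shows "\<exists>\<beta>. (\<forall>w\<in>S. 0 \<le> \<beta> w) \<and> p = (\<Sum>w\<in>S. \<beta> w *\<^sub>R w)"
proof -
  define K where "K = {p. \<exists>\<beta>. (\<forall>w\<in>S. 0 \<le> \<beta> w) \<and> p = (\<Sum>w\<in>S. \<beta> w *\<^sub>R w)}"
  have "S \<subseteq> K"
  proof
    fix w assume "w \<in> S"
    then show "w \<in> K"
      using \<open>finite S\<close> unfolding K_def
      by (auto intro!: exI[of _ "\<lambda>v. if v = w then 1 else 0"] simp: if_distrib[of "\<lambda>c. c *\<^sub>R _"] cong: if_cong)
  qed
  moreover have "convex_cone K"
    unfolding convex_cone_iff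
  proof (intro conjI ballI allI impI)
    show "0 \<in> K" by (auto simp: K_def intro!: exI[of _ "\<lambda>_. 0"])
    fix x y assume "x \<in> K" "y \<in> K"
    then obtain a b where "\<forall>w\<in>S. 0 \<le> a w" "x = (\<Sum>w\<in>S. a w *\<^sub>R w)"
      "\<forall>w\<in>S. 0 \<le> b w" "y = (\<Sum>w\<in>S. b w *\<^sub>R w)" unfolding K_def by auto
    then show "x + y \<in> K" unfolding K_def
      by (auto intro!: exI[of _ "\<lambda>w. a w + b w"] simp: sum.distrib scaleR_add_left)
  next
    fix x and c :: real assume "x \<in> K" "0 \<le> c"
    then obtain a where "\<forall>w\<in>S. 0 \<le> a w" "x = (\<Sum>w\<in>S. a w *\<^sub>R w)" unfolding K_def by auto
    then show "c *\<^sub>R x \<in> K" using \<open>0 \<le> c\<close> unfolding K_def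
      by (auto intro!: exI[of _ "\<lambda>w. c * a w"] simp: scaleR_sum_right)
  qed
  ultimately have "convex_cone hull S \<subseteq> K" by (rule hull_minimal)
  with assms(2) show ?thesis by (auto simp: K_def)
qed

text \<open>\<open>p\<close> is the point of the cone closest to \<open>x\<close>. The variational
  inequality at \<open>p + w\<close> gives the sign of \<open>(x - p) \<bullet> w\<close>; at
  \<open>0\<close> it gives \<open>(x - p) \<bullet> p \<ge> 0\<close>, a sum of nonpositive terms,
  so each term vanishes.\<close>

lemma cone_projection:
  fixes S :: "'a::euclidean_space set"
  assumes "finite S"
  obtains \<beta> p where "\<And>w. w \<in> S \<Longrightarrow> 0 \<le> \<beta> w" "p = (\<Sum>w\<in>S. \<beta> w *\<^sub>R w)"
    "\<And>w. w \<in> S \<Longrightarrow> (x - p) \<bullet> w \<le> 0" "\<And>w. w \<in> S \<Longrightarrow> \<beta> w > 0 \<Longrightarrow> (x - p) \<bullet> w = 0"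
proof -
  define K where "K = convex_cone hull S"
  define p where "p = closest_point K x"
  have K: "closed K" "convex K" "K \<noteq> {}"
    using assms by (auto simp: K_def closed_convex_cone_hull convex_convex_cone_hull convex_cone_hull_nonempty)
  have pK: "p \<in> K" unfolding p_def by (rule closest_point_in_set[OF K(1,3)])
  have dot: "(x - p) \<bullet> (y - p) \<le> 0" if "y \<in> K" for y
    unfolding p_def by (rule closest_point_dot[OF K(2,1) that])
  obtain \<beta> where \<beta>: "\<forall>w\<in>S. 0 \<le> \<beta> w" "p = (\<Sum>w\<in>S. \<beta> w *\<^sub>R w)"
    using convex_cone_hull_finite_sum[OF assms] pK unfolding K_def by blast
  have neg: "(x - p) \<bullet> w \<le> 0" if "w \<in> S" for w
    using dot[of "p + w"] pK that
    by (simp add: K_def convex_cone_hull_add hull_inc)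
  have "(x - p) \<bullet> p \<ge> 0"
    using dot[of 0] by (simp add: K_def convex_cone_hull_contains_0)
  then have "(\<Sum>w\<in>S. \<beta> w * ((x - p) \<bullet> w)) \<ge> 0"
    by (subst (asm) (2) \<beta>(2)) (simp add: inner_sum_right)
  moreover have "\<And>w. w \<in> S \<Longrightarrow> \<beta> w * ((x - p) \<bullet> w) \<le> 0"
    using neg \<beta>(1) by (simp add: mult_nonneg_nonpos)
  ultimately have "\<And>w. w \<in> S \<Longrightarrow> \<beta> w * ((x - p) \<bullet> w) = 0"
    using sum_nonpos[of S "\<lambda>w. \<beta> w * ((x - p) \<bullet> w)"]
      sum_nonneg_eq_0_iff[OF assms, of "\<lambda>w. - (\<beta> w * ((x - p) \<bullet> w))"]
    by (auto simp: sum_negf)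
  with \<beta> neg that show ?thesis by fastforce
qed

section \<open>The box-constrained quadratic problem\<close>

lemma compact_unit_cube_fun: "compact {t :: 'a \<Rightarrow> real. \<forall>i. t i \<in> {0..1}}"
proof -
  have "{t :: 'a \<Rightarrow> real. \<forall>i. t i \<in> {0..1}} = PiE UNIV (\<lambda>_. {0..1})"
    by (auto simp: PiE_def)
  moreover have "compactin (product_topology (\<lambda>_. euclidean) UNIV) (PiE UNIV (\<lambda>_::'a. {0..1::real}))"
    by (subst compactin_PiE) auto
  ultimately show ?thesis
    by (simp only: euclidean_product_topology compactin_euclidean_iff)
qed

text \<open>Here \<open>w \<bullet> u - w \<bullet> w\<close> is the partial derivative of the
  objective in the coordinate \<open>w\<close>. The bound by 1 ensures that adding a whole
  Gram-Schmidt residual covers the contribution of one vector.\<close>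

definition kkt_point :: "'a::euclidean_space set \<Rightarrow> ('a \<Rightarrow> real) \<Rightarrow> 'a \<Rightarrow> bool" where
  "kkt_point W \<mu> u \<longleftrightarrow> u = (\<Sum>w\<in>W. \<mu> w *\<^sub>R w) \<and>
     (\<forall>w\<in>W. 0 \<le> \<mu> w \<and> \<mu> w \<le> 1 \<and> w \<bullet> w \<le> w \<bullet> u \<and> (\<mu> w > 0 \<longrightarrow> w \<bullet> u = w \<bullet> w))"

lemma nonneg_if_quadratic_nonneg:
  fixes a b d :: real
  assumes "0 < d" and "\<And>e. 0 < e \<Longrightarrow> e \<le> d \<Longrightarrow> e * a + e\<^sup>2 * b / 2 \<ge> 0"
  shows "a \<ge> 0"
proof (rule ccontr)
  assume "\<not> a \<ge> 0"
  \<comment> \<open>For this \<open>e\<close>, \<open>e * b \<le> - a\<close>, so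
    \<open>a + e * b / 2 \<le> a / 2 < 0\<close>.\<close>
  define e where "e = min d (- a / (\<bar>b\<bar> + 1))"
  have e: "0 < e" "e \<le> d" "e * (\<bar>b\<bar> + 1) \<le> - a"
  proof -
    have "e * (\<bar>b\<bar> + 1) \<le> (- a / (\<bar>b\<bar> + 1)) * (\<bar>b\<bar> + 1)"
      by (intro mult_right_mono) (auto simp: e_def)
    also have "\<dots> = - a"
      by (subst times_divide_eq_left, subst nonzero_mult_div_cancel_right) auto
    finally show "e * (\<bar>b\<bar> + 1) \<le> - a" .
  qed (use \<open>\<not> a \<ge> 0\<close> assms(1) in \<open>auto simp: e_def intro!: divide_neg_pos\<close>)
  have "0 \<le> e * (a + e * b / 2)"
    using assms(2)[OF e(1,2)] by (simp add: power2_eq_square algebra_simps)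
  then have "0 \<le> a + e * b / 2" using e(1) by (simp add: zero_le_mult_iff)
  moreover have "e * b \<le> e * (\<bar>b\<bar> + 1)" using e(1) by (intro mult_left_mono) auto
  ultimately show False using e(3) \<open>\<not> a \<ge> 0\<close> by linarith
qed

lemma kkt_point_exists:
  fixes W :: "'a::euclidean_space set"
  assumes "finite W" and acute: "\<And>v w. v \<in> W \<Longrightarrow> w \<in> W \<Longrightarrow> v \<bullet> w \<ge> 0"
  obtains \<mu> u where "kkt_point W \<mu> u"
proof -
  define C where "C = {t :: 'a \<Rightarrow> real. \<forall>i. t i \<in> {0..1}}"
  define S where "S = (\<lambda>\<mu>. \<Sum>w\<in>W. \<mu> w *\<^sub>R w)"
  define F where "F = (\<lambda>\<mu>. (S \<mu> \<bullet> S \<mu>) / 2 - (\<Sum>w\<in>W. \<mu> w * (w \<bullet> w)))"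
  have "continuous_on C F"
    unfolding F_def S_def
    by (intro continuous_intros) (auto intro: continuous_on_subset[OF continuous_on_product_coordinates])
  moreover have "C \<noteq> {}" by (auto simp: C_def intro!: exI[of _ "\<lambda>_. 0"])
  ultimately obtain \<mu> where \<mu>: "\<mu> \<in> C" and min: "\<And>\<nu>. \<nu> \<in> C \<Longrightarrow> F \<mu> \<le> F \<nu>"
    using continuous_attains_inf[of C F] compact_unit_cube_fun by (auto simp: C_def)
  define u where "u = S \<mu>"
  \<comment> \<open>The left side is the exact change of \<open>F\<close> when coordinate
    \<open>w\<close> moves by \<open>e\<close>.\<close>
  have shift: "e * (w \<bullet> u - w \<bullet> w) + e\<^sup>2 * (w \<bullet> w) / 2 \<ge> 0"
    if "w \<in> W" "0 \<le> \<mu> w + e" "\<mu> w + e \<le> 1" for w e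
  proof -
    have "\<mu>(w := \<mu> w + e) \<in> C" using \<mu> that by (auto simp: C_def)
    moreover have "S (\<mu>(w := \<mu> w + e)) = u + e *\<^sub>R w"
      using that(1) assms(1) by (simp add: S_def u_def sum.remove scaleR_add_left)
    moreover have "(\<Sum>v\<in>W. (\<mu>(w := \<mu> w + e)) v * (v \<bullet> v)) = (\<Sum>v\<in>W. \<mu> v * (v \<bullet> v)) + e * (w \<bullet> w)"
      using that(1) assms(1) by (simp add: sum.remove distrib_right)
    ultimately have "(u \<bullet> u) / 2 \<le> ((u + e *\<^sub>R w) \<bullet> (u + e *\<^sub>R w)) / 2 - e * (w \<bullet> w)"
      using min[of "\<mu>(w := \<mu> w + e)"] by (simp add: F_def u_def)
    then show ?thesis
      by (simp add: inner_add_left inner_add_right inner_commute power2_eq_square algebra_simps)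
  qed
  have box: "0 \<le> \<mu> w" "\<mu> w \<le> 1" for w using \<mu> by (auto simp: C_def)
  have ge: "w \<bullet> w \<le> w \<bullet> u" if w: "w \<in> W" for w
  proof (cases "\<mu> w < 1")
    case True
    have "w \<bullet> u - w \<bullet> w \<ge> 0"
    proof (rule nonneg_if_quadratic_nonneg[of "1 - \<mu> w" _ "w \<bullet> w"])
      fix e assume "0 < e" "e \<le> 1 - \<mu> w"
      then show "e * (w \<bullet> u - w \<bullet> w) + e\<^sup>2 * (w \<bullet> w) / 2 \<ge> 0"
        using shift[OF w, of e] box[of w] by simp
    qed (use True in simp)
    then show ?thesis by simp
  next
    case False
    \<comment> \<open>The coordinate cannot grow here. Its own term already contributes
      \<open>w \<bullet> w\<close> to \<open>w \<bullet> u\<close>, and acuteness makes the others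
      nonnegative.\<close>
    then have "\<mu> w = 1" using box[of w] by simp
    then have "w \<bullet> u = w \<bullet> w + (\<Sum>v\<in>W - {w}. \<mu> v * (w \<bullet> v))"
      using w assms(1) by (simp add: u_def S_def sum.remove inner_sum_right inner_add_right)
    also have "\<dots> \<ge> w \<bullet> w"
      using w acute box by (auto intro!: sum_nonneg)
    finally show ?thesis .
  qed
  have "w \<bullet> u \<le> w \<bullet> w" if w: "w \<in> W" and "\<mu> w > 0" for w
  proof -
    \<comment> \<open>Lowering \<open>\<mu> w\<close> by up to its own value stays in the box, which
      gives the reverse inequality.\<close>
    have "- (w \<bullet> u - w \<bullet> w) \<ge> 0"
    proof (rule nonneg_if_quadratic_nonneg[of "\<mu> w" _ "w \<bullet> w"])
      fix e assume "0 < e" "e \<le> \<mu> w"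
      then show "e * - (w \<bullet> u - w \<bullet> w) + e\<^sup>2 * (w \<bullet> w) / 2 \<ge> 0"
        using shift[OF w, of "- e"] box[of w] by (simp add: algebra_simps)
    qed fact
    then show ?thesis by simp
  qed
  with ge box have "kkt_point W \<mu> u"
    by (force simp: kkt_point_def u_def S_def)
  then show ?thesis by (rule that)
qed

section \<open>Gram-Schmidt sums dominating the minimiser\<close>

text \<open>Greedy completion: as projections are self-adjoint, adding \<open>w\<close> changes
  \<open>p \<bullet> residual_sum ws\<close> by \<open>r \<bullet> w\<close>, with \<open>r\<close>
  the residual of \<open>p\<close>. Until the list spans \<open>A\<close>, some vector outside its
  span gives a nonnegative change.\<close>

lemma extend_indep_list:
  fixes A :: "'a::euclidean_space set"
  assumes "finite A" and \<beta>: "\<And>w. w \<in> A \<Longrightarrow> 0 \<le> \<beta> w" and p: "p = (\<Sum>w\<in>A. \<beta> w *\<^sub>R w)"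
    and "indep_list ws" "set ws \<subseteq> A"
  shows "\<exists>ws'. indep_list ws' \<and> set ws' \<subseteq> A \<and> A \<subseteq> span (set ws') \<and>
    p \<bullet> residual_sum ws \<le> p \<bullet> residual_sum ws'"
  using assms(4,5)
proof (induction "card (A - span (set ws))" arbitrary: ws rule: less_induct)
  case less
  show ?case
  proof (cases "A \<subseteq> span (set ws)")
    case False
    \<comment> \<open>Some \<open>w\<close> has \<open>r \<bullet> w \<ge> 0\<close>, since \<open>r \<bullet> r = r \<bullet> p\<close> is a nonnegative combination of the \<open>r \<bullet> w\<close>.\<close>
    define r where "r = p - orth_proj (set ws) p"
    have "\<exists>w \<in> A - span (set ws). r \<bullet> w \<ge> 0"
    proof (rule ccontr)
      assume "\<not> ?thesis"
      then have neg: "\<And>w. w \<in> A - span (set ws) \<Longrightarrow> r \<bullet> w < 0" by (meson not_le)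
      have "r \<bullet> r = r \<bullet> p"
        using orth_proj_residual[OF orth_proj_in_span[of "set ws" p], of p]
        by (simp add: r_def inner_diff_right)
      also have "\<dots> = (\<Sum>w\<in>A. \<beta> w * (r \<bullet> w))"
        by (subst p) (simp add: inner_sum_right)
      also have "\<dots> \<le> 0"
      proof (rule sum_nonpos)
        fix w assume "w \<in> A"
        then have "r \<bullet> w \<le> 0"
          using neg[of w] orth_proj_residual[of w "set ws" p] by (cases "w \<in> span (set ws)") (auto simp: r_def)
        then show "\<beta> w * (r \<bullet> w) \<le> 0" using \<beta>[OF \<open>w \<in> A\<close>] by (simp add: mult_nonneg_nonpos)
      qed
      finally have "r = 0" by (metis inner_gt_zero_iff not_le)
      with False neg show False by auto
    qed
    then obtain w where w: "w \<in> A" "w \<notin> span (set ws)" "r \<bullet> w \<ge> 0" by auto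
    have "A - span (set (w # ws)) \<subset> A - span (set ws)"
      using w span_mono[of "set ws" "set (w # ws)"] span_base[of w "set (w # ws)"] by auto
    then have "card (A - span (set (w # ws))) < card (A - span (set ws))"
      using assms(1) by (intro psubset_card_mono) auto
    from less.hyps[OF this] less.prems w obtain ws' where
      "indep_list ws' \<and> set ws' \<subseteq> A \<and> A \<subseteq> span (set ws') \<and>
        p \<bullet> residual_sum (w # ws) \<le> p \<bullet> residual_sum ws'"
      by auto
    moreover have "p \<bullet> residual_sum ws \<le> p \<bullet> residual_sum (w # ws)"
      using w(3) orth_proj_residual_sym[of p "set ws" w] by (simp add: r_def inner_add_right)
    ultimately show ?thesis by fastforce
  qed (use less.prems in auto)
qed

lemma sum_scaleR_support:
  fixes \<mu> :: "'a::real_vector \<Rightarrow> real"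
  assumes "finite W" "\<And>w. w \<in> W \<Longrightarrow> 0 \<le> \<mu> w"
  shows "(\<Sum>w\<in>W. \<mu> w *\<^sub>R w) = (\<Sum>w | w \<in> W \<and> 0 < \<mu> w. \<mu> w *\<^sub>R w)"
  using assms by (intro sum.mono_neutral_right) (auto simp: less_le)

lemma residual_sum_ge_kkt:
  fixes W :: "'a::euclidean_space set"
  assumes "finite W" and "\<And>v w. v \<in> W \<Longrightarrow> w \<in> W \<Longrightarrow> v \<bullet> w \<ge> 0" and "kkt_point W \<mu> u"
  shows "\<exists>ws. indep_list ws \<and> set ws \<subseteq> W \<and> x \<bullet> u \<le> x \<bullet> residual_sum ws"
  using assms
proof (induction "card W" arbitrary: W \<mu> u x rule: less_induct)
  case less
  define T where "T = {w \<in> W. \<mu> w > 0}"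
  have finT: "finite T" using less.prems(1) by (simp add: T_def)
  have u: "u = (\<Sum>w\<in>T. \<mu> w *\<^sub>R w)"
    using less.prems(1,3) unfolding kkt_point_def T_def by (auto intro: sum_scaleR_support)
  show ?case
  proof (cases "T = {}")
    case True
    then show ?thesis using u by (intro exI[of _ "[]"]) simp
  next
    case False
    then obtain k where k: "k \<in> T" by blast
    obtain \<beta> p where \<beta>: "\<And>w. w \<in> T - {k} \<Longrightarrow> 0 \<le> \<beta> w" and p: "p = (\<Sum>w\<in>T - {k}. \<beta> w *\<^sub>R w)"
      and neg: "\<And>w. w \<in> T - {k} \<Longrightarrow> (x - p) \<bullet> w \<le> 0"
      and zero: "\<And>w. w \<in> T - {k} \<Longrightarrow> \<beta> w > 0 \<Longrightarrow> (x - p) \<bullet> w = 0"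
      using cone_projection[of "T - {k}" x] finT by blast
    define A where "A = {w \<in> T - {k}. \<beta> w > 0}"
    have A: "finite A" "A \<subseteq> W" "A \<subset> W" using finT k finite_subset[of A T] by (auto simp: A_def T_def)
    have pA: "p = (\<Sum>w\<in>A. \<beta> w *\<^sub>R w)"
      unfolding p A_def using finT \<beta> by (intro sum_scaleR_support) auto
    have cardA: "card A < card W" using A less.prems(1) by (simp add: psubset_card_mono)
    obtain \<nu> v where kkt: "kkt_point A \<nu> v"
      using kkt_point_exists[OF A(1)] less.prems(2) A(2) by blast
    obtain ws0 where "indep_list ws0" "set ws0 \<subseteq> A" and ws0: "p \<bullet> v \<le> p \<bullet> residual_sum ws0"
      using less.hyps[OF cardA A(1) _ kkt, of p] less.prems(2) A(2) by blast
    \<comment> \<open>Once the list spans \<open>A\<close>, its span contains \<open>p\<close> and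
      is orthogonal to \<open>x - p\<close>; the residual of \<open>k\<close> then has value exactly
      \<open>(x - p) \<bullet> k\<close> under \<open>x\<close>.\<close>
    from extend_indep_list[OF A(1) _ pA this(1,2)] obtain ws where
      ws: "indep_list ws" "set ws \<subseteq> A" "A \<subseteq> span (set ws)"
        "p \<bullet> residual_sum ws0 \<le> p \<bullet> residual_sum ws"
      by (auto simp: A_def)
    have orth: "(x - p) \<bullet> s = 0" if "s \<in> span (set ws)" for s
    proof -
      have "orthogonal (x - p) s"
      proof (rule orthogonal_to_span[OF that])
        fix w assume "w \<in> set ws"
        then have "w \<in> A" using ws(2) by blast
        then show "orthogonal (x - p) w"
          using zero[of w] by (simp add: A_def orthogonal_def)
      qed
      then show ?thesis by (simp add: orthogonal_def)
    qed
    have p_span: "p \<in> span (set ws)"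
      unfolding pA using ws(3) by (blast intro: span_sum span_scale)
    have "p \<bullet> u = (\<Sum>w\<in>A. \<beta> w * (w \<bullet> u))"
      by (simp add: pA inner_sum_left)
    \<comment> \<open>Vectors of \<open>A\<close> are active for \<open>u\<close>, so
      \<open>w \<bullet> u = w \<bullet> w\<close>, which is at most \<open>w \<bullet> v\<close> as
      \<open>v\<close> satisfies the inequalities for \<open>A\<close>.\<close>
    also have "\<dots> \<le> (\<Sum>w\<in>A. \<beta> w * (w \<bullet> v))"
      using less.prems(3) kkt
      by (intro sum_mono mult_left_mono) (auto simp: kkt_point_def A_def T_def)
    also have "\<dots> = p \<bullet> v" by (simp add: pA inner_sum_left)
    finally have pu: "p \<bullet> u \<le> p \<bullet> residual_sum ws" using ws0 ws(4) by simp
    have "(x - p) \<bullet> u = \<mu> k * ((x - p) \<bullet> k) + (\<Sum>w\<in>T - {k}. \<mu> w * ((x - p) \<bullet> w))"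
      using k finT by (simp add: u inner_sum_right inner_add_right sum.remove)
    also have "(\<Sum>w\<in>T - {k}. \<mu> w * ((x - p) \<bullet> w)) \<le> 0"
      using neg by (intro sum_nonpos mult_nonneg_nonpos) (auto simp: T_def)
    finally have tu: "(x - p) \<bullet> u \<le> \<mu> k * ((x - p) \<bullet> k)" by simp
    have xws: "x \<bullet> residual_sum ws = p \<bullet> residual_sum ws"
      using orth[OF residual_sum_in_span] by (simp add: inner_diff_left)
    have \<mu>k: "0 \<le> \<mu> k" "\<mu> k \<le> 1" using k less.prems(3) by (auto simp: T_def kkt_point_def)
    show ?thesis
    proof (cases "(x - p) \<bullet> k > 0")
      case True
      have "x \<bullet> (k - orth_proj (set ws) k) = (x - p) \<bullet> k"
        using orth_proj_residual[OF p_span, of k] orth[OF orth_proj_in_span]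
        by (simp add: inner_diff_left inner_diff_right inner_commute)
      moreover have "\<mu> k * ((x - p) \<bullet> k) \<le> (x - p) \<bullet> k"
        using \<mu>k True by (simp add: mult_left_le_one_le)
      ultimately have "x \<bullet> u \<le> x \<bullet> residual_sum (k # ws)"
        using pu tu xws by (simp add: inner_add_right inner_diff_left)
      moreover have "k \<notin> span (set ws)" using orth True by force
      ultimately show ?thesis
        using ws A(2) k by (intro exI[of _ "k # ws"]) (auto simp: T_def)
    next
      case False
      \<comment> \<open>With no positive gain from \<open>k\<close>, the list spanning
        \<open>A\<close> suffices by itself.\<close>
      then have "\<mu> k * ((x - p) \<bullet> k) \<le> 0" using \<mu>k by (simp add: mult_nonneg_nonpos)
      then have "x \<bullet> u \<le> x \<bullet> residual_sum ws"
        using pu tu xws by (simp add: inner_diff_left)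
      then show ?thesis using ws A(2) by blast
    qed
  qed
qed

section \<open>Membership in \<open>U\<close> and the theorem\<close>

lemma OEP_kkt_mem:
  fixes U U' :: "(real^'m) set"
  assumes "OEP U' U" "0 \<in> U" "compact U" "convex U" "finite W" "W \<subseteq> U'"
    and acute: "\<And>v w. v \<in> W \<Longrightarrow> w \<in> W \<Longrightarrow> v \<bullet> w \<ge> 0" and "kkt_point W \<mu> u"
  shows "u \<in> U"
proof (rule ccontr)
  assume "u \<notin> U"
  then obtain a b where ab: "a \<bullet> u < b" "\<And>y. y \<in> U \<Longrightarrow> a \<bullet> y > b"
    using separating_hyperplane_closed_point[OF \<open>convex U\<close> compact_imp_closed[OF \<open>compact U\<close>]] by blast
  \<comment> \<open>\<open>a\<close> is smaller at \<open>u\<close> than on \<open>U\<close>, so the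
    bound is applied to \<open>- a\<close>.\<close>
  obtain ws where ws: "indep_list ws" "set ws \<subseteq> W" "- a \<bullet> u \<le> - a \<bullet> residual_sum ws"
    using residual_sum_ge_kkt[OF \<open>finite W\<close> acute \<open>kkt_point W \<mu> u\<close>, of "- a"] by blast
  have "residual_sum ws \<in> U"
    using residual_sum_in_OEP_superset[OF assms(1,2) ws(1)] ws(2) \<open>W \<subseteq> U'\<close> acute by blast
  with ab ws(3) show False by fastforce
qed

theorem theorem1:
  fixes f :: "(real^'n1) \<times> (real^'n2) \<Rightarrow> real^'n2"
    and g1 :: "real^'n1 \<Rightarrow> real^'n2^'n1"
    and g2 :: "real^'n1 \<Rightarrow> real^'m^'n2"
    and U U' :: "(real^'m) set"
    and N1 N2 M :: nat
    and \<kappa> :: "nat \<Rightarrow> real^'n1 \<Rightarrow> real"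
    and \<eta> :: "nat \<Rightarrow> real^'n2 \<Rightarrow> real"
    and h :: "nat \<Rightarrow> (real^'n1) \<times> (real^'n2) \<Rightarrow> real"
    and \<alpha> :: "nat \<Rightarrow> real \<Rightarrow> real"
  assumes "C2 f" and "C2 g1" and "C2 g2"
    and "compact U" and "convex U" and "0 \<in> U"
    and "\<And>i. i \<in> {1..N1} \<Longrightarrow> C2 (\<kappa> i)"
    and "\<And>j. j \<in> {1..N2} \<Longrightarrow> C1 (\<eta> j)"
    and "U' \<subseteq> U" and "OEP U' U"
    and "\<And>k. k \<in> {1..M} \<Longrightarrow> scbf_with f g1 g2 (safe_set N1 N2 \<kappa> \<eta>) U' (h k) (\<alpha> k)"
    and "non_interfering g2 (safe_set N1 N2 \<kappa> \<eta>) M h"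
  shows "\<forall>(q, v) \<in> safe_set N1 N2 \<kappa> \<eta> \<inter> (\<Inter>k\<in>{1..M}. Hset (h k)).
           (\<Inter>k\<in>{1..M}. mu f g1 g2 (h k) (\<alpha> k) q v U) \<noteq> {}"
proof clarify
  fix q v
  assume safe: "(q, v) \<in> safe_set N1 N2 \<kappa> \<eta>" and H: "(q, v) \<in> (\<Inter>k\<in>{1..M}. Hset (h k))"
    and empty: "(\<Inter>k\<in>{1..M}. mu f g1 g2 (h k) (\<alpha> k) q v U) = {}"
  define d where "d k = grad_v (h k) q v v* g2 q" for k
  have d_acute: "d i \<bullet> d j \<ge> 0" if "i \<in> {1..M}" "j \<in> {1..M}" for i j
    using assms(12) safe that unfolding non_interfering_def d_def by blast
  have "\<forall>k\<in>{1..M}. \<exists>w. w \<in> mu f g1 g2 (h k) (\<alpha> k) q v U' \<and> (\<exists>c\<ge>0. w = - (c *\<^sub>R d k))"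
  proof
    fix k assume k: "k \<in> {1..M}"
    then have "(q, v) \<in> Hset (h k) \<inter> safe_set N1 N2 \<kappa> \<eta>" using safe H by blast
    then show "\<exists>w. w \<in> mu f g1 g2 (h k) (\<alpha> k) q v U' \<and> (\<exists>c\<ge>0. w = - (c *\<^sub>R d k))"
      using assms(11)[OF k] unfolding scbf_with_def d_def by blast
  qed
  then obtain w c where w: "\<And>k. k \<in> {1..M} \<Longrightarrow> w k \<in> mu f g1 g2 (h k) (\<alpha> k) q v U'"
    and c: "\<And>k. k \<in> {1..M} \<Longrightarrow> 0 \<le> c k" "\<And>k. k \<in> {1..M} \<Longrightarrow> w k = - (c k *\<^sub>R d k)"
    by metis
  define W where "W = w ` {1..M}"
  have W: "finite W" "W \<subseteq> U'" using w by (auto simp: W_def mu_def)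
  have W_acute: "a \<bullet> b \<ge> 0" if "a \<in> W" "b \<in> W" for a b
    using that c d_acute by (auto simp: W_def)
  obtain \<mu> u where kkt: "kkt_point W \<mu> u" using kkt_point_exists[OF W(1) W_acute] by blast
  have "u \<in> U"
    using OEP_kkt_mem[OF assms(10,6,4,5) W W_acute kkt] .
  \<comment> \<open>\<open>hdot\<close> is affine in the control with linear part
    \<open>d k\<close>, so this comparison carries the bound satisfied by \<open>w k\<close> over to
    \<open>u\<close>.\<close>
  have "d k \<bullet> u \<le> d k \<bullet> w k" if k: "k \<in> {1..M}" for k
  proof (cases "c k = 0")
    case True
    \<comment> \<open>With \<open>w k = 0\<close> the inequality
      \<open>w k \<bullet> w k \<le> w k \<bullet> u\<close> is void. Instead, \<open>u\<close> is a
      nonnegative combination of vectors \<open>- (c j *\<^sub>R d j)\<close>, none of which has a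
      positive inner product with \<open>d k\<close>.\<close>
    have "d k \<bullet> b \<le> 0" if "b \<in> W" for b
      using that c d_acute[OF k] by (auto simp: W_def)
    then have "d k \<bullet> u \<le> 0"
      using kkt by (auto simp: kkt_point_def inner_sum_right intro!: sum_nonpos mult_nonneg_nonpos)
    with True c(2)[OF k] show ?thesis by simp
  next
    case False
    have "w k \<bullet> w k \<le> w k \<bullet> u" using kkt k by (auto simp only: kkt_point_def W_def)
    then have "- (c k * (d k \<bullet> w k)) \<le> - (c k * (d k \<bullet> u))"
      using c(2)[OF k] by (metis inner_minus_left inner_scaleR_left)
    with False c(1)[OF k] show ?thesis by simp
  qed
  then have "hdot f g1 g2 (h k) q v u \<le> hdot f g1 g2 (h k) q v (w k)" if "k \<in> {1..M}" for k
    using that by (simp add: hdot_def d_def inner_add_right flip: dot_lmul_matrix)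
  then have "u \<in> (\<Inter>k\<in>{1..M}. mu f g1 g2 (h k) (\<alpha> k) q v U)"
    using w \<open>u \<in> U\<close> by (fastforce simp: mu_def)
  with empty show False by blast
qed

end
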